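(* For $k=0,1,2,\ldots$ let $l_k=\tfrac{1}{2^k}$, $t_k=\tfrac12(l_{k+1}+l_k)$ and $s_k=1+2^{-2k}$, and let $p_k$ be the unique polynomial of degree at most nine satisfying the ten conditions: $p_k$ and $-t^2$ agree up to and including their respective third derivatives at $t=l_{k+1}$ and at $t=l_k$; $p_k(t_k)=-t_k^2$; and $p_k'(t_k)=s_k\cdot(-2t_k)$. Define $f_1:[-1,1]\to\mathbb{R}$ by $$f_1(t)=\begin{cases} p_k(t) & \text{if } t\in[l_{k+1},l_k] \text{ for } k=0,1,2,\ldots,\\ -t^2 & \text{if } t\in[-1,0],\end{cases}$$ and let $f_2(t)=f_1(-t)$ for $t\in[-1,1]$. Then $t=0$ is an isolated maximizer of $f_1$, as well as an isolated maximizer of $f_{\max}=\max(f_1,f_2)$.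
   Context: A (local) maximizer of a function is isolated if some neighborhood of it contains no other local maximizer of the function. $\max(f_1,f_2)$ is the pointwise maximum. *)

theory Defs
  imports "HOL-Analysis.Analysis" "HOL-Computational_Algebra.Polynomial"
begin

definition l_seq :: "nat \<Rightarrow> real" where
  "l_seq k = 1 / 2 ^ k"

definition t_seq :: "nat \<Rightarrow> real" where
  "t_seq k = (1 / 2) * (l_seq (k + 1) + l_seq k)"

definition s_seq :: "nat \<Rightarrow> real" where
  "s_seq k = 1 + 1 / 2 ^ (2 * k)"

definition neg_square :: "real poly" where
  "neg_square = [:0, 0, -1:]"

definition agree_to_order :: "nat \<Rightarrow> real poly \<Rightarrow> real poly \<Rightarrow> real \<Rightarrow> bool" where
  "agree_to_order n q r x \<longleftrightarrow> (\<forall>j\<le>n. poly ((pderiv ^^ j) q) x = poly ((pderiv ^^ j) r) x)"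

definition interpolates :: "nat \<Rightarrow> real poly \<Rightarrow> bool" where
  "interpolates k q \<longleftrightarrow>
     degree q \<le> 9 \<and>
     agree_to_order 3 q neg_square (l_seq (k + 1)) \<and>
     agree_to_order 3 q neg_square (l_seq k) \<and>
     poly q (t_seq k) = - (t_seq k)\<^sup>2 \<and>
     poly (pderiv q) (t_seq k) = s_seq k * (- 2 * t_seq k)"

(* Well defined: see ex1_interpolates below. *)
definition p_poly :: "nat \<Rightarrow> real poly" where
  "p_poly k = (THE q. interpolates k q)"

(* Adjacent intervals share an end point, at which the two polynomials take the same value;
   the choice made by LEAST there is therefore immaterial (see f1_eq_poly below).
   Values outside {-1..1} are never used. *)
definition f1 :: "real \<Rightarrow> real" where
  "f1 t = (if t \<le> 0 then - t\<^sup>2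
           else poly (p_poly (LEAST k. t \<in> {l_seq (k + 1)..l_seq k})) t)"

definition f2 :: "real \<Rightarrow> real" where
  "f2 t = f1 (- t)"

definition f_max :: "real \<Rightarrow> real" where
  "f_max t = max (f1 t) (f2 t)"

definition local_maximizer_on ::
    "('a::topological_space \<Rightarrow> real) \<Rightarrow> 'a set \<Rightarrow> 'a \<Rightarrow> bool" where
  "local_maximizer_on f S x \<longleftrightarrow> x \<in> S \<and> (\<forall>\<^sub>F y in at x within S. f y \<le> f x)"

(* The point itself is required to be a global maximizer over S, while isolation
   excludes all other local maximizers near it. *)
definition isolated_maximizer_on ::
    "('a::topological_space \<Rightarrow> real) \<Rightarrow> 'a set \<Rightarrow> 'a \<Rightarrow> bool" where
  "isolated_maximizer_on f S x \<longleftrightarrow>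
     is_arg_max f (\<lambda>y. y \<in> S) x \<and> x isolated_in {y. local_maximizer_on f S y}"

lemma power_dvd_iff_higher_pderiv:
  fixes d :: "real poly"
  shows "[:- a, 1:] ^ n dvd d \<longleftrightarrow> (\<forall>j<n. poly ((pderiv ^^ j) d) a = 0)"
proof (induction n arbitrary: d)
  case 0
  show ?case by simp
next
  case (Suc n)
  have shift: "(\<forall>j<Suc n. poly ((pderiv ^^ j) d) a = 0) \<longleftrightarrow>
      poly d a = 0 \<and> (\<forall>j<n. poly ((pderiv ^^ j) (pderiv d)) a = 0)"
    by (auto simp: less_Suc_eq_0_disj funpow_Suc_right simp del: funpow.simps)
  show ?case
  proof (cases "d = 0 \<or> poly d a \<noteq> 0")
    case True
    then show ?thesis unfolding shift
      by (auto simp: order_divides order_0I simp del: power_Suc)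
  next
    case False
    then have d: "d \<noteq> 0" "poly d a = 0" by auto
    have "pderiv d \<noteq> 0"
      using d pderiv_iszero[of d] by auto
    moreover from this have "order a d = Suc (order a (pderiv d))"
      using d order_pderiv order_root by blast
    ultimately show ?thesis unfolding shift Suc.IH[symmetric]
      using d by (simp add: order_divides del: power_Suc)
  qed
qed

lemma agree_to_order_iff_dvd:
  "agree_to_order n q r x \<longleftrightarrow> [:- x, 1:] ^ Suc n dvd q - r"
proof -
  have "(pderiv ^^ j) (q - r) = (pderiv ^^ j) q - (pderiv ^^ j) r" for j
    by (induction j) (simp_all add: pderiv_diff)
  then show ?thesis
    unfolding agree_to_order_def power_dvd_iff_higher_pderiv by (auto simp: less_Suc_eq_le)
qed

lemma ex1_interpolates: "\<exists>!q. interpolates k q"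
proof -
  define a b m where "a = l_seq (k + 1)" and "b = l_seq k" and "m = t_seq k"
  have ne: "a \<noteq> b" "a \<noteq> m" "b \<noteq> m"
    by (simp_all add: a_def b_def m_def t_seq_def l_seq_def field_simps)
  define w where "w = [:- a, 1:] ^ 4 * [:- b, 1:] ^ 4 * [:- m, 1:]"
  have degw: "degree w = 9"
    by (simp add: w_def degree_mult_eq degree_power_eq del: mult_pCons_right mult_pCons_left)
  have pm: "poly w m = 0" by (simp add: w_def)
  have w': "poly (pderiv w) m \<noteq> 0"
    using ne by (simp add: w_def pderiv_mult pderiv_pCons del: mult_pCons_right mult_pCons_left)
  have dvdw: "[:- a, 1:] ^ 4 * [:- b, 1:] ^ 4 dvd w"
    unfolding w_def by (rule dvd_triv_left)
  have four: "Suc 3 = 4" by simp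
  define c where "c = (s_seq k * (- 2 * m) + 2 * m) / poly (pderiv w) m"
  have E: "interpolates k (neg_square + smult c w)"
    unfolding interpolates_def agree_to_order_iff_dvd four
      a_def[symmetric] b_def[symmetric] m_def[symmetric]
  proof (intro conjI)
    show "degree (neg_square + smult c w) \<le> 9"
      by (rule degree_add_le) (auto simp: neg_square_def degw)
    show "[:- a, 1:] ^ 4 dvd neg_square + smult c w - neg_square"
      using dvd_mult_left[OF dvdw] by (simp add: dvd_smult)
    show "[:- b, 1:] ^ 4 dvd neg_square + smult c w - neg_square"
      using dvd_mult_right[OF dvdw] by (simp add: dvd_smult)
    show "poly (neg_square + smult c w) m = - m\<^sup>2"
      by (simp add: pm neg_square_def power2_eq_square)
    show "poly (pderiv (neg_square + smult c w)) m = s_seq k * (- 2 * m)"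
      using w' by (simp add: pderiv_add pderiv_smult neg_square_def pderiv_pCons c_def)
  qed
  have U: "q = r" if q: "interpolates k q" and r: "interpolates k r" for q r
  proof (rule ccontr)
    assume "q \<noteq> r"
    define d where "d = q - r"
    have d0: "d \<noteq> 0" using \<open>q \<noteq> r\<close> by (simp add: d_def)
    have degd: "degree d \<le> 9"
      unfolding d_def using q r by (intro degree_diff_le) (auto simp: interpolates_def)
    have at: "[:- x, 1:] ^ 4 dvd d" if "x = a \<or> x = b" for x
    proof -
      have "[:- x, 1:] ^ 4 dvd (q - neg_square) - (r - neg_square)"
        using q r that unfolding interpolates_def agree_to_order_iff_dvd four a_def b_def
        by (elim disjE conjE) (simp_all only: dvd_diff)
      then show ?thesis by (simp add: d_def)
    qed
    have "[:- m, 1:] ^ 2 dvd d"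
      unfolding power_dvd_iff_higher_pderiv using q r
      by (auto simp: d_def interpolates_def m_def pderiv_diff less_2_cases_iff)
    then have ord: "4 \<le> order a d" "4 \<le> order b d" "2 \<le> order m d"
      using at[of a] at[of b] d0 by (simp_all add: order_divides)
    have "order a d + order b d + order m d = (\<Sum>x\<in>{a, b, m}. order x d)"
      using ne by simp
    also have "\<dots> \<le> (\<Sum>x | poly d x = 0. order x d)"
      using ord d0 by (intro sum_mono2 poly_roots_finite) (auto simp: order_root)
    also have "\<dots> \<le> degree d"
      by (rule sum_order_le_degree[OF d0])
    finally show False using ord degd by simp
  qed
  from E U show ?thesis by blast
qed

lemma interpolates_p_poly: "interpolates k (p_poly k)"
  unfolding p_poly_def by (rule theI'[OF ex1_interpolates])

lemma f1_eq_poly: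
  assumes "t \<in> {l_seq (k + 1)..l_seq k}"
  shows "f1 t = poly (p_poly k) t"
proof -
  define i where "i = (LEAST k. t \<in> {l_seq (k + 1)..l_seq k})"
  have i: "t \<in> {l_seq (i + 1)..l_seq i}" "i \<le> k"
    unfolding i_def using assms
    by (rule LeastI[where P = "\<lambda>k. t \<in> {l_seq (k + 1)..l_seq k}"],
        rule Least_le[where P = "\<lambda>k. t \<in> {l_seq (k + 1)..l_seq k}"])
  have "0 < l_seq (k + 1)" by (simp add: l_seq_def)
  then have f1: "f1 t = poly (p_poly i) t"
    using assms by (simp add: f1_def i_def)
  have anti: "l_seq n \<le> l_seq m" if "m \<le> n" for m n
    using that by (simp add: l_seq_def field_simps)
  have ends: "poly (p_poly n) (l_seq (n + 1)) = poly neg_square (l_seq (n + 1))"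
    "poly (p_poly n) (l_seq n) = poly neg_square (l_seq n)" for n
    using interpolates_p_poly[of n] unfolding interpolates_def agree_to_order_def
    by (auto dest: spec[of _ 0])
  show ?thesis
  proof (cases "i = k")
    case False
    then have "t = l_seq (i + 1)" "l_seq k = l_seq (i + 1)"
      using i assms anti[of "i + 1" k] by auto
    then show ?thesis using f1 ends(1)[of i] ends(2)[of k] by simp
  qed (use f1 in simp)
qed

lemma f1_eq_neg_square: "t \<in> {-1..0} \<Longrightarrow> f1 t = - t\<^sup>2"
  by (simp add: f1_def)

end

theory Submission
  imports Defs
begin

text \<open>
  On \<open>[h, 2 h]\<close> with \<open>h = l_seq (k + 1)\<close> one has, in the coordinate \<open>t = h (3 + v) / 2\<close> with
  \<open>v \<in> [-1, 1]\<close>, that \<open>p_poly k\<close> equals \<open>- t\<^sup>2 - 6 h\<^sup>4 v (1 - v\<^sup>2)\<^sup>4\<close>. The perturbation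
  has slope at most \<open>(6 h\<^sup>4) (16 / 27)\<close> in \<open>v\<close>, while \<open>- t\<^sup>2\<close> has slope at most \<open>- h\<^sup>2\<close>; as
  \<open>h \<le> 1 / 2\<close>, the sum decreases strictly. So \<open>f1\<close>, and with it the even function \<open>f_max\<close>,
  increases strictly on \<open>[-1, 0]\<close> and decreases strictly on \<open>[0, 1]\<close>.
\<close>

text \<open>At any \<open>y\<close> other than \<open>c\<close>, arbitrarily small moves towards
  \<open>c\<close> increase \<open>f\<close>, so \<open>c\<close> is the only local
  maximizer.\<close>

lemma isolated_maximizer_on_strict_peak:
  fixes f :: "real \<Rightarrow> real"
  assumes c: "c \<in> {a..b}"
    and inc: "\<And>x y. a \<le> x \<Longrightarrow> x < y \<Longrightarrow> y \<le> c \<Longrightarrow> f x < f y"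
    and dec: "\<And>x y. c \<le> x \<Longrightarrow> x < y \<Longrightarrow> y \<le> b \<Longrightarrow> f y < f x"
  shows "isolated_maximizer_on f {a..b} c"
proof -
  have le: "f y \<le> f c" if "y \<in> {a..b}" for y
    using that inc[of y c] dec[of c y] by (cases y c rule: linorder_cases) auto
  have cmax: "local_maximizer_on f {a..b} c"
    using c le by (auto simp: local_maximizer_on_def eventually_at_filter)
  have only: "y = c" if y: "local_maximizer_on f {a..b} y" for y
  proof (rule ccontr)
    assume "y \<noteq> c"
    obtain d where d: "0 < d" and
      near: "\<And>z. z \<in> {a..b} \<Longrightarrow> z \<noteq> y \<Longrightarrow> dist z y < d \<Longrightarrow> f z \<le> f y"
      using y unfolding local_maximizer_on_def eventually_at by blast
    have yab: "y \<in> {a..b}" using y by (simp add: local_maximizer_on_def)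
    show False
    proof (cases "y < c")
      case True
      define z where "z = min c (y + d / 2)"
      have "y < z" "z \<le> c" "dist z y < d" using True d by (auto simp: z_def dist_real_def)
      then show False using near[of z] inc[of y z] yab c by auto
    next
      case False
      define z where "z = max c (y - d / 2)"
      have "z < y" "c \<le> z" "dist z y < d"
        using False \<open>y \<noteq> c\<close> d by (auto simp: z_def dist_real_def)
      then show False using near[of z] dec[of z y] yab c by auto
    qed
  qed
  have "{y. local_maximizer_on f {a..b} y} = {c}" using cmax only by blast
  then show ?thesis
    \<comment> \<open>With \<open>c\<close> as the sole local maximizer, the whole line serves as
      the isolating neighborhood.\<close>
    using c le by (auto simp: isolated_maximizer_on_def is_arg_max_def isolated_in_def not_less
        intro!: exI[of _ UNIV])
qed

text \<open>By uniqueness it suffices to check the ten conditions. The perturbation is a multiple of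
  \<open>w\<close>, which vanishes to order four at both end points and once at the midpoint; nine
  conditions then hold for every factor, and the slope at the midpoint fixes it.\<close>

lemma poly_p_poly:
  fixes k :: nat
  defines "h \<equiv> l_seq (k + 1)"
  shows "poly (p_poly k) t =
    - t\<^sup>2 - 3072 / h ^ 5 * (((t - h) * (t - 2 * h)) ^ 4 * (t - 3 * h / 2))"
proof -
  define w where "w = [:- h, 1:] ^ 4 * [:- (2 * h), 1:] ^ 4 * [:- (3 * h / 2), 1:]"
  define q where "q = neg_square + smult (- 3072 / h ^ 5) w"
  have h: "h > 0" by (simp add: h_def l_seq_def)
  have l: "l_seq (k + 1) = h" "l_seq k = 2 * h" "t_seq k = 3 * h / 2" "s_seq k = 1 + 4 * h\<^sup>2"
    by (simp_all add: h_def l_seq_def t_seq_def s_seq_def power_mult_distrib power_divide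
        power_mult[symmetric] mult.commute)
  have degw: "degree w = 9"
    by (simp add: w_def degree_mult_eq degree_power_eq del: mult_pCons_right mult_pCons_left)
  have pw: "poly w x = (x - h) ^ 4 * (x - 2 * h) ^ 4 * (x - 3 * h / 2)" for x
    by (simp add: w_def algebra_simps)
  \<comment> \<open>Only the term differentiating the simple factor survives:
    \<open>(h / 2) ^ 4 * (- h / 2) ^ 4\<close>.\<close>
  have dw: "poly (pderiv w) (3 * h / 2) = h ^ 8 / 256"
    by (simp add: w_def pderiv_mult pderiv_pCons field_simps
        del: mult_pCons_right mult_pCons_left)
  have dvdw: "[:- h, 1:] ^ 4 * [:- (2 * h), 1:] ^ 4 dvd w"
    unfolding w_def by (rule dvd_triv_left)
  have four: "Suc 3 = 4" by simp
  have "interpolates k q"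
    unfolding interpolates_def agree_to_order_iff_dvd four l q_def
  proof (intro conjI)
    show "degree (neg_square + smult (- 3072 / h ^ 5) w) \<le> 9"
      by (rule degree_add_le) (auto simp: neg_square_def degw)
    show "[:- h, 1:] ^ 4 dvd neg_square + smult (- 3072 / h ^ 5) w - neg_square"
      using dvd_mult_left[OF dvdw] by (simp add: dvd_smult)
    show "[:- (2 * h), 1:] ^ 4 dvd neg_square + smult (- 3072 / h ^ 5) w - neg_square"
      using dvd_mult_right[OF dvdw] by (simp add: dvd_smult)
    show "poly (neg_square + smult (- 3072 / h ^ 5) w) (3 * h / 2) = - (3 * h / 2)\<^sup>2"
      by (simp add: pw neg_square_def power2_eq_square)
    \<comment> \<open>The excess slope required is \<open>4 * h\<^sup>2 * (- 3 * h)\<close>, that is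
      \<open>- 12 * h ^ 3\<close>; dividing by \<open>h ^ 8 / 256\<close> gives the factor
      \<open>- 3072 / h ^ 5\<close>.\<close>
    have c: "3072 / h ^ 5 * poly (pderiv w) (3 * h / 2) = 12 * h ^ 3"
      unfolding dw using h by (simp add: field_simps flip: power_add)
    have d: "poly (pderiv (neg_square + smult (- 3072 / h ^ 5) w)) x =
        - (2 * x) - 3072 / h ^ 5 * poly (pderiv w) x" for x
      by (simp add: pderiv_add pderiv_diff pderiv_smult neg_square_def pderiv_pCons)
    show "poly (pderiv (neg_square + smult (- 3072 / h ^ 5) w)) (3 * h / 2) =
        (1 + 4 * h\<^sup>2) * (- 2 * (3 * h / 2))"
      unfolding d c by (simp add: algebra_simps power2_eq_square power3_eq_cube)
  qed
  then have "p_poly k = q"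
    using ex1_interpolates interpolates_p_poly by blast
  then show ?thesis
    by (simp add: q_def pw neg_square_def power2_eq_square power_mult_distrib)
qed

text \<open>With \<open>x\<close> the square of \<open>v\<close>, the left side is minus the
  derivative of \<open>v * (1 - v\<^sup>2) ^ 4\<close>.\<close>

lemma quartic_bound:
  fixes x :: real
  assumes "0 \<le> x" "x \<le> 1"
  shows "(1 - x) ^ 3 * (9 * x - 1) \<le> 16 / 27"
proof -
  define y where "y = 1 - x"
  \<comment> \<open>The maximum is attained at \<open>y = 2 / 3\<close>, hence the squared factor;
    the cofactor has positive coefficients.\<close>
  have "16 / 27 - y ^ 3 * (8 - 9 * y) = (3 * y - 2)\<^sup>2 * (y\<^sup>2 + 4 / 9 * y + 4 / 27)"
    by (simp add: field_simps power2_eq_square power3_eq_cube)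
  moreover have "0 \<le> (3 * y - 2)\<^sup>2 * (y\<^sup>2 + 4 / 9 * y + 4 / 27)"
    using assms by (intro mult_nonneg_nonneg add_nonneg_nonneg) (auto simp: y_def)
  ultimately show ?thesis by (simp add: y_def algebra_simps)
qed

lemma p_poly_strict_antimono:
  assumes xy: "x < y" and x: "l_seq (k + 1) \<le> x" and y: "y \<le> l_seq k"
  shows "poly (p_poly k) y < poly (p_poly k) x"
proof -
  define h where "h = l_seq (k + 1)"
  have h: "0 < h" "h \<le> 1 / 2" and lk: "l_seq k = 2 * h"
    by (simp_all add: h_def l_seq_def field_simps)
  have h2: "h\<^sup>2 \<le> 1 / 4"
    using power_mono[OF h(2), of 2] h by (simp add: power2_eq_square)
  \<comment> \<open>\<open>F\<close> is \<open>p_poly k\<close> in the variable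
    \<open>u = t / h\<close>, which ranges over [1, 2] for every \<open>k\<close>.\<close>
  define F where "F u = - (h * u)\<^sup>2 - 3072 * h ^ 4 * (((u - 1) * (u - 2)) ^ 4 * (u - 3 / 2))"
    for u :: real
  have pF: "poly (p_poly k) (h * u) = F u" for u
  proof -
    have "((h * u - h) * (h * u - 2 * h)) ^ 4 * (h * u - 3 * h / 2) =
        h ^ 9 * (((u - 1) * (u - 2)) ^ 4 * (u - 3 / 2))"
    proof -
      have "(h * u - h) * (h * u - 2 * h) = h\<^sup>2 * ((u - 1) * (u - 2))"
        "h * u - 3 * h / 2 = h * (u - 3 / 2)"
        by (simp_all add: algebra_simps power2_eq_square)
      then show ?thesis
        by (simp add: power_mult_distrib eval_nat_numeral)
    qed
    moreover have "3072 / h ^ 5 * h ^ 9 = 3072 * h ^ 4"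
      using h by (simp add: field_simps flip: power_add)
    ultimately show ?thesis
      unfolding poly_p_poly h_def[symmetric] F_def by (metis mult.assoc)
  qed
  have "F (y / h) < F (x / h)"
  proof (rule DERIV_neg_imp_decreasing[where f = F])
    show "x / h < y / h" using xy h by (simp add: divide_strict_right_mono)
  next
    fix u assume "x / h \<le> u" "u \<le> y / h"
    moreover have "1 \<le> x / h" "y / h \<le> 2" using x y h(1) lk unfolding h_def[symmetric]
      by (simp_all add: pos_le_divide_eq pos_divide_le_eq)
    ultimately have u: "1 \<le> u" "u \<le> 2" by linarith+
    \<comment> \<open>\<open>2 * u - 3\<close> is the centered coordinate \<open>v\<close>, so
      \<open>z\<close> is its square.\<close>
    define z where "z = (2 * u - 3)\<^sup>2"
    have "\<bar>2 * u - 3\<bar> \<le> 1" using u by auto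
    then have z: "0 \<le> z" "z \<le> 1" unfolding z_def by (auto simp: abs_square_le_1)
    define D where "D = - (2 * h\<^sup>2 * u) + 12 * h ^ 4 * ((1 - z) ^ 3 * (9 * z - 1))"
    have Q: "(u - 1) * (u - 2) = (z - 1) / 4"
      by (simp add: z_def power2_eq_square field_simps)
    have "(F has_real_derivative - (2 * h\<^sup>2 * u) - 3072 * h ^ 4 *
        (4 * ((u - 1) * (u - 2)) ^ 3 * (2 * u - 3) * (u - 3 / 2) + ((u - 1) * (u - 2)) ^ 4)) (at u)"
      unfolding F_def
      by (auto intro!: derivative_eq_intros simp: power2_eq_square algebra_simps)
    also have "4 * ((u - 1) * (u - 2)) ^ 3 * (2 * u - 3) * (u - 3 / 2) =
        2 * ((u - 1) * (u - 2)) ^ 3 * z"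
      by (simp add: z_def power2_eq_square algebra_simps)
    also have "- (2 * h\<^sup>2 * u) - 3072 * h ^ 4 *
        (2 * ((u - 1) * (u - 2)) ^ 3 * z + ((u - 1) * (u - 2)) ^ 4) = D"
      unfolding Q D_def by (simp add: field_simps eval_nat_numeral)
    finally have "(F has_real_derivative D) (at u)" .
    moreover have "D < 0"
    proof -
      have "12 * h ^ 4 * ((1 - z) ^ 3 * (9 * z - 1)) \<le> 12 * h ^ 4 * (16 / 27)"
        using h by (intro mult_left_mono quartic_bound z) auto
      also have "\<dots> = h\<^sup>2 * (64 / 9 * h\<^sup>2)" by (simp add: eval_nat_numeral)
      \<comment> \<open>As \<open>h\<^sup>2\<close> is at most 1/4, the factor on the left is at
        most 16/9, while \<open>2 * u\<close> is at least 2.\<close>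
      also have "\<dots> < h\<^sup>2 * (2 * u)"
        using h h2 u by (intro mult_strict_left_mono) auto
      finally show ?thesis by (simp add: D_def)
    qed
    ultimately show "\<exists>D. (F has_real_derivative D) (at u) \<and> D < 0" by blast
  qed
  then show ?thesis using pF[of "y / h"] pF[of "x / h"] h by simp
qed

lemma l_seq_pos: "0 < l_seq k"
  by (simp add: l_seq_def)

lemma ex_l_seq_less:
  assumes "0 < x"
  obtains k where "l_seq k < x"
proof -
  obtain k where "(1 / 2) ^ k < x"
    using real_arch_pow_inv[OF assms, of "1 / 2"] by auto
  then show thesis by (intro that[of k]) (simp add: l_seq_def power_divide)
qed

lemma f1_l_seq: "f1 (l_seq k) = - (l_seq k)\<^sup>2"
proof -
  have "l_seq k \<in> {l_seq (k + 1)..l_seq k}" by (simp add: l_seq_def field_simps)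
  from f1_eq_poly[OF this] show ?thesis
    by (simp add: poly_p_poly) (simp add: l_seq_def)
qed

text \<open>Each induction step adds the next piece on the left; the base case is vacuous because
  \<open>l_seq 0 = 1\<close>.\<close>

lemma f1_strict_antimono_from_l_seq:
  assumes "l_seq k \<le> x" "x < y" "y \<le> 1"
  shows "f1 y < f1 x"
  using assms
proof (induction k arbitrary: x y)
  case 0
  then show ?case by (simp add: l_seq_def)
next
  case (Suc k)
  have piece: "f1 y < f1 x" if "l_seq (Suc k) \<le> x" "x < y" "y \<le> l_seq k" for x y
    using that p_poly_strict_antimono[of x y k] by (simp add: f1_eq_poly[of _ k])
  consider "l_seq k \<le> x" | "y \<le> l_seq k" | "x < l_seq k" "l_seq k < y" by linarith
  then show ?case
  proof cases
    \<comment> \<open>The points lie on either side of the joint \<open>l_seq k\<close>, so the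
      comparison passes through it.\<close>
    case 3
    then have "f1 y < f1 (l_seq k)" "f1 (l_seq k) < f1 x"
      using Suc piece by auto
    then show ?thesis by simp
  qed (use Suc piece in auto)
qed

lemma f1_strict_antimono:
  assumes "0 \<le> x" "x < y" "y \<le> 1"
  shows "f1 y < f1 x"
proof (cases "x = 0")
  \<comment> \<open>No finite number of pieces reaches 0, so some \<open>l_seq k\<close> below
    \<open>y\<close> is interposed, where \<open>f1\<close> is already negative.\<close>
  case True
  obtain k where k: "l_seq k < y" using ex_l_seq_less[of y] assms by auto
  have "f1 y < f1 (l_seq k)"
    using f1_strict_antimono_from_l_seq[of k "l_seq k" y] k assms by simp
  also have "\<dots> < 0" using l_seq_pos[of k] by (simp add: f1_l_seq)
  finally show ?thesis using True by (simp add: f1_def)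
next
  case False
  then obtain k where "l_seq k < x" using ex_l_seq_less[of x] assms by auto
  then show ?thesis using f1_strict_antimono_from_l_seq assms by (meson less_imp_le)
qed

lemma f1_strict_mono:
  assumes "x < y" "y \<le> 0"
  shows "f1 x < f1 y"
  using assms power_strict_mono[of "- y" "- x" 2] by (simp add: f1_def)

theorem theorem3p2:
  shows "isolated_maximizer_on f1 {-1..1} 0 \<and> isolated_maximizer_on f_max {-1..1} 0"
proof
  show "isolated_maximizer_on f1 {-1..1} 0"
    by (rule isolated_maximizer_on_strict_peak) (auto intro: f1_strict_mono f1_strict_antimono)
  \<comment> \<open>To the right of 0 both \<open>f1\<close> and its reflection \<open>f2\<close>
    decrease strictly, hence so does their maximum.\<close>
  have dec: "f_max y < f_max x" if "0 \<le> x" "x < y" "y \<le> 1" for x y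
    using f1_strict_antimono[of x y] f1_strict_mono[of "- y" "- x"] that
    by (auto simp: f_max_def f2_def max_def)
  have even: "f_max (- x) = f_max x" for x
    by (simp add: f_max_def f2_def max.commute)
  have inc: "f_max x < f_max y" if "-1 \<le> x" "x < y" "y \<le> 0" for x y
    using dec[of "- y" "- x"] that by (simp add: even)
  show "isolated_maximizer_on f_max {-1..1} 0"
    by (rule isolated_maximizer_on_strict_peak) (auto intro: inc dec)
qed

end
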